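(* Let $E$ be a real normed vector space, $\Omega\subset E$ a nonempty open set, $\hat{x}\in\Omega$, and let $(f_n)_{n\in\mathbb{N}}$ be a sequence of functions $f_n:\Omega\to\mathbb{R}$ satisfying property $(H)$ at $\hat{x}$, with limit function $f_\infty$. Suppose that $\hat{x}$ is an optimal solution of the problem $$(\mathcal{P}_\infty)\qquad \min f_0(x)\quad\text{subject to } x\in\Omega,\ f_n(x)\le 0\ \ \forall n\geq 1 .$$ Then there exists a sequence of real numbers $(\alpha_{\infty},\alpha_0,\alpha_1,\ldots)$ such that: (i) $\alpha_{\infty}\geq 0$, $\alpha_n\geq 0$ for all $n\in \mathbb{N}$ and $\alpha_{\infty}+\sum_{n\geq 0} \alpha_n=1$; (ii) $\alpha_{\infty} f_{\infty}(\hat{x})=0$ and $\alpha_{n}f_n(\hat{x})= 0$ for all $n\geq 1$; (iii) $\alpha_{\infty} D^+f_{\infty}(\hat{x})(u)+\sum_{n\geq 0} \alpha_{n} D^+f_n(\hat{x})(u) \geq 0$ for all $u\in E$. Moreover: - if there exists $w\in E$ such that $\sup_{n\geq 1} D^+ f_n(\hat{x})(w) < 0$, then $\alpha_{0}\neq 0$; - if $f_n$ is Gateaux-differentiable at $\hat{x}$ for all $n\in \mathbb{N}$, then $\alpha_{\infty}\, d_G f_{\infty}(\hat{x})(u) + \sum_{n\geq 0} \alpha_{n}\, d_G f_n(\hat{x})(u)= 0$ for all $u\in E$.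
   Context: $\mathbb{N}=\{0,1,2,\ldots\}$. An optimal solution of $(\mathcal{P}_\infty)$ is a feasible point (a point of $\Omega$ satisfying all constraints) at which $f_0$ attains its minimum over all feasible points. For $f$ real-valued near $x$, the upper Dini derivative at $x$ in direction $u\in E$ is $D^+ f(x)(u) :=\limsup_{t\to 0^+} \frac{f(x+tu)-f(x)}{t}$ (and $D^+f(x)(0)=0$). A function $p:E\to\mathbb{R}$ is sublinear if $p(x+y)\le p(x)+p(y)$ and $p(\lambda x)=\lambda p(x)$ for all $x,y\in E$ and real $\lambda\ge 0$. $f$ is Gateaux-differentiable at $x$ if there is a continuous linear functional $d_Gf(x)$ on $E$ with $\lim_{t\to 0}\frac{f(x+tu)-f(x)}{t}=d_Gf(x)(u)$ for all $u\in E$; then $D^+f(x)=d_Gf(x)$. Let $B(\hat{x},r)$ be the open ball of center $\hat{x}$ and radius $r\in(0,+\infty]$ (with $B(\hat x,+\infty)=E$). For a real-valued Lipschitz function $h$ on $B(\hat{x},r)\cap\Omega$ put $\|h\|_{\hat{x},r}=\sup_{x\ne y\in B(\hat{x},r)\cap\Omega}\frac{|h(x)-h(y)|}{\|x-y\|}$. Property $(H)$ at $\hat{x}$: there is $r\in(0,+\infty]$ such that every $f_n$ is Lipschitz on $B(\hat{x},r)\cap\Omega$, and: (i) $D^+f_n(\hat{x})$ is sublinear for all $n\in\mathbb{N}$; (ii) there exists a real-valued function $f_\infty$, Lipschitz on $B(\hat{x},r)\cap\Omega$, such that $f_\infty(\hat{x})=\lim_{n\to\infty}f_n(\hat{x})$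 and $\|f_n-f_\infty\|_{\hat{x},r}\to 0$ as $n\to\infty$. When $(H)$ holds and all $f_n$ are Gateaux-differentiable at $\hat{x}$, so is $f_\infty$. *)

theory Defs
  imports "HOL-Analysis.Analysis"
begin

text \<open>
  Functions on an open set \<open>\<Omega>\<close> are represented by total functions on the space; only the values
  on \<open>\<Omega>\<close> are ever constrained, and directional limits at a point of \<open>\<Omega>\<close> do not
  depend on the values outside.
\<close>

definition upper_Dini :: "('a::real_normed_vector \<Rightarrow> real) \<Rightarrow> 'a \<Rightarrow> 'a \<Rightarrow> ereal" where
  "upper_Dini f x u = Limsup (at_right 0) (\<lambda>t. ereal ((f (x + t *\<^sub>R u) - f x) / t))"

text \<open>
  The real-valued version is only meaningful where \<^const>\<open>upper_Dini\<close> is finite; by the lemma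
  below this is always the case for functions that are Lipschitz near the point.
\<close>

definition Dini :: "('a::real_normed_vector \<Rightarrow> real) \<Rightarrow> 'a \<Rightarrow> 'a \<Rightarrow> real" where
  "Dini f x u = real_of_ereal (upper_Dini f x u)"

lemma ereal_Dini:
  fixes f :: "'a::real_normed_vector \<Rightarrow> real"
  assumes "open S" "x \<in> S" "L-lipschitz_on S f"
  shows "ereal (Dini f x u) = upper_Dini f x u"
proof -
  have "((\<lambda>t. x + t *\<^sub>R u) \<longlongrightarrow> x + 0 *\<^sub>R u) (at_right 0)"
    by (intro tendsto_intros)
  then have inS: "\<forall>\<^sub>F t in at_right 0. x + t *\<^sub>R u \<in> S"
    using topological_tendstoD[of _ _ _ S] assms(1,2) by auto
  have ev: "\<forall>\<^sub>F t in at_right 0. \<bar>(f (x + t *\<^sub>R u) - f x) / t\<bar> \<le> L * norm u"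
    using inS eventually_at_right_less[of "0::real"]
  proof eventually_elim
    case (elim t)
    have "\<bar>f (x + t *\<^sub>R u) - f x\<bar> \<le> L * norm (t *\<^sub>R u)"
      using lipschitz_onD[OF assms(3) elim(1) assms(2)] by (simp add: dist_norm)
    then show ?case
      using elim(2) by (simp add: field_simps)
  qed
  have "upper_Dini f x u \<le> ereal (L * norm u)"
    unfolding upper_Dini_def
    by (rule Limsup_bounded, rule eventually_mono[OF ev]) (simp only: ereal_less_eq abs_le_iff)
  moreover have "ereal (- (L * norm u)) \<le> upper_Dini f x u"
  proof -
    have "ereal (- (L * norm u))
        \<le> Liminf (at_right 0) (\<lambda>t. ereal ((f (x + t *\<^sub>R u) - f x) / t))"
      by (rule Liminf_bounded, rule eventually_mono[OF ev]) (simp only: ereal_less_eq abs_le_iff minus_le_iff)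
    also have "\<dots> \<le> upper_Dini f x u"
      unfolding upper_Dini_def by (rule Liminf_le_Limsup) simp
    finally show ?thesis .
  qed
  ultimately show ?thesis
    unfolding Dini_def by (cases "upper_Dini f x u") auto
qed

definition sublinear :: "('a::real_vector \<Rightarrow> real) \<Rightarrow> bool" where
  "sublinear p \<longleftrightarrow>
     (\<forall>x y. p (x + y) \<le> p x + p y) \<and> (\<forall>x. \<forall>c\<ge>0. p (c *\<^sub>R x) = c * p x)"

definition has_Gateaux_derivative ::
  "('a::real_normed_vector \<Rightarrow> real) \<Rightarrow> 'a \<Rightarrow> ('a \<Rightarrow> real) \<Rightarrow> bool" where
  "has_Gateaux_derivative f x d \<longleftrightarrow>
     bounded_linear d \<and> (\<forall>u. ((\<lambda>t. (f (x + t *\<^sub>R u) - f x) / t) \<longlongrightarrow> d u) (at 0))"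

definition Gateaux_differentiable :: "('a::real_normed_vector \<Rightarrow> real) \<Rightarrow> 'a \<Rightarrow> bool" where
  "Gateaux_differentiable f x \<longleftrightarrow> (\<exists>d. has_Gateaux_derivative f x d)"

definition Gateaux_derivative :: "('a::real_normed_vector \<Rightarrow> real) \<Rightarrow> 'a \<Rightarrow> 'a \<Rightarrow> real" where
  "Gateaux_derivative f x = (THE d. has_Gateaux_derivative f x d)"

lemma Gateaux_derivative_eqI:
  assumes "has_Gateaux_derivative f x d"
  shows "Gateaux_derivative f x = d"
  unfolding Gateaux_derivative_def
proof (rule the_equality)
  show "has_Gateaux_derivative f x d" by (fact assms)
next
  fix e assume e: "has_Gateaux_derivative f x e"
  show "e = d"
  proof
    fix u
    let ?q = "\<lambda>t. (f (x + t *\<^sub>R u) - f x) / t"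
    have "(?q \<longlongrightarrow> e u) (at 0)" "(?q \<longlongrightarrow> d u) (at 0)"
      using e assms unfolding has_Gateaux_derivative_def by blast+
    then show "e u = d u"
      by (rule tendsto_unique[OF trivial_limit_at])
  qed
qed

text \<open>Open balls whose radius may be infinite.\<close>

definition ext_ball :: "'a::metric_space \<Rightarrow> ereal \<Rightarrow> 'a set" where
  "ext_ball x r = {y. ereal (dist x y) < r}"

lemma ext_ball_ereal: "ext_ball x (ereal r) = ball x r"
  by (auto simp: ext_ball_def ball_def)

lemma ext_ball_infinity: "ext_ball x \<infinity> = UNIV"
  by (auto simp: ext_ball_def)

text \<open>
  The smallest Lipschitz constant on a set. Taking the supremum in \<^typ>\<open>ennreal\<close> makes it
  \<open>0\<close> when the set has at most one point, and \<open>\<infinity>\<close> for a function that is not Lipschitz there.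
\<close>

definition lip_seminorm :: "'a::real_normed_vector set \<Rightarrow> ('a \<Rightarrow> real) \<Rightarrow> ennreal" where
  "lip_seminorm S h =
     (SUP (x, y) \<in> {(x, y). x \<in> S \<and> y \<in> S \<and> x \<noteq> y}. ennreal (\<bar>h x - h y\<bar> / norm (x - y)))"

definition property_H ::
  "'a::real_normed_vector set \<Rightarrow> (nat \<Rightarrow> 'a \<Rightarrow> real) \<Rightarrow> 'a \<Rightarrow> ('a \<Rightarrow> real) \<Rightarrow> bool" where
  "property_H \<Omega> f xh finf \<longleftrightarrow>
     (\<exists>r>0.
        (\<forall>n. \<exists>L. L-lipschitz_on (ext_ball xh r \<inter> \<Omega>) (f n)) \<and>
        (\<forall>n. sublinear (Dini (f n) xh)) \<and>
        (\<exists>L. L-lipschitz_on (ext_ball xh r \<inter> \<Omega>) finf) \<and>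
        (\<lambda>n. f n xh) \<longlonglongrightarrow> finf xh \<and>
        (\<lambda>n. lip_seminorm (ext_ball xh r \<inter> \<Omega>) (\<lambda>x. f n x - finf x)) \<longlonglongrightarrow> 0)"

definition feasible_set :: "'a set \<Rightarrow> (nat \<Rightarrow> 'a \<Rightarrow> real) \<Rightarrow> 'a set" where
  "feasible_set \<Omega> f = {x \<in> \<Omega>. \<forall>n\<ge>1. f n x \<le> 0}"

definition optimal_solution :: "'a set \<Rightarrow> (nat \<Rightarrow> 'a \<Rightarrow> real) \<Rightarrow> 'a \<Rightarrow> bool" where
  "optimal_solution \<Omega> f xh \<longleftrightarrow>
     xh \<in> feasible_set \<Omega> f \<and> (\<forall>x\<in>feasible_set \<Omega> f. f 0 xh \<le> f 0 x)"

end

(*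
  Since the f_n converge to f_infinity in the Lipschitz seminorm, no direction u can make the
  Dini derivatives of f_0 and of all active constraints negative, the constraint f_infinity being
  active when f_infinity(xh) = 0: otherwise xh + t u is feasible for small t > 0 and decreases f_0.
  Replacing inactive constraints by the limit derivative (or by that of f_0 if f_infinity is
  inactive) gives a pointwise convergent sequence F_n of sublinear functions with
  sup_n F_n(u) >= 0 for every u.  On bounded sequences q(x) = inf_u sup_n (x_n + F_n(u)) is then a
  sublinear functional; a linear functional below q is a mean on the bounded sequences that is
  nonnegative on every (F_n(u))_n, and its values on unit vectors are the multipliers.
*)
theory Submission
  imports Defs
begin

section \<open>Sublinear functionals and the Hahn-Banach theorem\<close>

lemma sublinear_add: "sublinear p \<Longrightarrow> p (x + y) \<le> p x + p y"
  and sublinear_scale: "sublinear p \<Longrightarrow> c \<ge> 0 \<Longrightarrow> p (c *\<^sub>R x) = c * p x"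
  by (auto simp: sublinear_def)

lemma sublinear_zero: "sublinear p \<Longrightarrow> p 0 = 0"
  using sublinear_scale[of p 0 0] by simp

text \<open>Each pair of indices, and each rescaling of one index, is answered by some index that
  does at least as well. This form covers all three infima taken below: over shifts along a ray,
  over a chain, and over the directions \<open>u\<close> in the functional \<open>q\<close>.\<close>

lemma sublinear_INF:
  fixes \<Phi> :: "'i \<Rightarrow> 'a::real_vector \<Rightarrow> real"
  assumes ne: "I \<noteq> {}"
    and add: "\<And>i j. i \<in> I \<Longrightarrow> j \<in> I \<Longrightarrow> \<exists>k\<in>I. \<forall>x y. \<Phi> k (x + y) \<le> \<Phi> i x + \<Phi> j y"
    and scale: "\<And>i c. i \<in> I \<Longrightarrow> c > 0 \<Longrightarrow> \<exists>k\<in>I. \<forall>x. \<Phi> k (c *\<^sub>R x) \<le> c * \<Phi> i x"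
    and zero: "\<And>i. i \<in> I \<Longrightarrow> 0 \<le> \<Phi> i 0"
  shows "bdd_below ((\<lambda>i. \<Phi> i x) ` I)" "sublinear (\<lambda>x. INF i\<in>I. \<Phi> i x)"
proof -
  obtain j where j: "j \<in> I" using ne by blast
  \<comment> \<open>A fixed \<open>j\<close> bounds all members from below:
    \<open>0 \<le> \<Phi> k 0 \<le> \<Phi> i x + \<Phi> j (-x)\<close> for some
    \<open>k\<close>.\<close>
  have bdd: "bdd_below ((\<lambda>i. \<Phi> i x) ` I)" for x
  proof (rule bdd_belowI2)
    fix i assume i: "i \<in> I"
    obtain k where k: "k \<in> I" "\<And>x y. \<Phi> k (x + y) \<le> \<Phi> i x + \<Phi> j y" using add[OF i j] by blast
    show "- \<Phi> j (-x) \<le> \<Phi> i x" using k(2)[of x "-x"] zero[OF k(1)] by simp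
  qed
  then show "bdd_below ((\<lambda>i. \<Phi> i x) ` I)" .
  define u where "u x = (INF i\<in>I. \<Phi> i x)" for x
  have u_le: "u x \<le> \<Phi> i x" if "i \<in> I" for x i
    unfolding u_def by (rule cINF_lower[OF bdd that])
  have u_ge: "b \<le> u x" if "\<And>i. i \<in> I \<Longrightarrow> b \<le> \<Phi> i x" for x b
    unfolding u_def by (rule cINF_greatest[OF ne that])
  have u_add: "u (x + y) \<le> u x + u y" for x y
  proof -
    have "u (x + y) - \<Phi> j y \<le> u x" if j: "j \<in> I" for j
    proof (rule u_ge)
      fix i assume i: "i \<in> I"
      obtain k where k: "k \<in> I" "\<Phi> k (x + y) \<le> \<Phi> i x + \<Phi> j y" using add[OF i j] by blast
      show "u (x + y) - \<Phi> j y \<le> \<Phi> i x" using u_le[OF k(1), of "x + y"] k(2) by linarith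
    qed
    then have "u (x + y) - u x \<le> u y" by (intro u_ge) (simp add: algebra_simps)
    then show ?thesis by simp
  qed
  have u_scale_le: "u (c *\<^sub>R x) \<le> c * u x" if c: "c > 0" for c x
  proof -
    have "u (c *\<^sub>R x) / c \<le> u x"
    proof (rule u_ge)
      fix i assume i: "i \<in> I"
      obtain k where k: "k \<in> I" "\<Phi> k (c *\<^sub>R x) \<le> c * \<Phi> i x" using scale[OF i c] by blast
      show "u (c *\<^sub>R x) / c \<le> \<Phi> i x"
        using u_le[OF k(1), of "c *\<^sub>R x"] k(2) c by (simp add: field_simps)
    qed
    then show ?thesis using c by (simp add: field_simps)
  qed
  \<comment> \<open>Scaling by 1/2 at the origin gives \<open>u 0 \<le> u 0 / 2\<close>, hence
    \<open>u 0 \<le> 0\<close>.\<close>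
  have u0: "u 0 = 0"
    using u_scale_le[of "1/2" 0] u_ge[of 0 0] zero by force
  have "u (c *\<^sub>R x) = c * u x" if "c \<ge> 0" for c x
  proof (cases "c = 0")
    case False
    then have c: "c > 0" using that by simp
    have "u x \<le> inverse c * u (c *\<^sub>R x)" using u_scale_le[of "inverse c" "c *\<^sub>R x"] c by simp
    then have "c * u x \<le> u (c *\<^sub>R x)" using c by (simp add: field_simps)
    then show ?thesis using u_scale_le[OF c, of x] by simp
  qed (simp add: u0)
  then show "sublinear (\<lambda>x. INF i\<in>I. \<Phi> i x)"
    using u_add unfolding sublinear_def u_def by blast
qed

text \<open>For fixed \<open>y\<close>, the infimum over \<open>t \<ge> 0\<close> of
  \<open>m (x + t *\<^sub>R y) - t * m y\<close> is again sublinear and lies below \<open>m\<close>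
  (take \<open>t = 0\<close>), so minimality makes it equal to \<open>m\<close>. The term
  \<open>t = 1\<close> then yields \<open>m x + m y \<le> m (x + y)\<close>, the reverse of
  subadditivity.\<close>

lemma minimal_sublinear_linear:
  fixes m :: "'a::real_vector \<Rightarrow> real"
  assumes m: "sublinear m"
    and min: "\<And>q. sublinear q \<Longrightarrow> q \<le> m \<Longrightarrow> q = m"
  shows "linear m"
proof -
  have add: "m (x + y) = m x + m y" for x y
  proof -
    define \<Phi> where "\<Phi> t x = m (x + t *\<^sub>R y) - t * m y" for t x
    define q where "q x = (INF t\<in>{0..}. \<Phi> t x)" for x
    have 1: "\<exists>k\<in>{0..}. \<forall>x y. \<Phi> k (x + y) \<le> \<Phi> s x + \<Phi> t y" if "s \<in> {0..}" "t \<in> {0..}" for s t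
    proof (intro bexI[of _ "s + t"] allI)
      fix v w
      have "v + w + (s + t) *\<^sub>R y = (v + s *\<^sub>R y) + (w + t *\<^sub>R y)" by (simp add: algebra_simps)
      then show "\<Phi> (s + t) (v + w) \<le> \<Phi> s v + \<Phi> t w"
        using sublinear_add[OF m, of "v + s *\<^sub>R y" "w + t *\<^sub>R y"]
        by (simp add: \<Phi>_def algebra_simps)
    qed (use that in auto)
    have 2: "\<exists>k\<in>{0..}. \<forall>x. \<Phi> k (c *\<^sub>R x) \<le> c * \<Phi> t x" if "t \<in> {0..}" "c > 0" for c t
    proof (intro bexI[of _ "c * t"] allI)
      fix v
      have "c *\<^sub>R v + (c * t) *\<^sub>R y = c *\<^sub>R (v + t *\<^sub>R y)" by (simp add: algebra_simps)
      then show "\<Phi> (c * t) (c *\<^sub>R v) \<le> c * \<Phi> t v"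
        using sublinear_scale[OF m, of c "v + t *\<^sub>R y"] that by (simp add: \<Phi>_def algebra_simps)
    qed (use that in auto)
    have 3: "0 \<le> \<Phi> t 0" if "t \<in> {0..}" for t
      using that sublinear_scale[OF m] by (simp add: \<Phi>_def)
    have bdd: "bdd_below ((\<lambda>t. \<Phi> t x) ` {0..})" for x
      by (rule sublinear_INF(1)) (use 1 2 3 in auto)
    have "sublinear q"
      unfolding q_def by (rule sublinear_INF(2)) (use 1 2 3 in auto)
    moreover have "q x \<le> \<Phi> t x" if "t \<ge> 0" for x t
      unfolding q_def by (rule cINF_lower[OF bdd]) (use that in simp)
    note q_le = this
    have "q \<le> m"
      using q_le[of 0] by (simp add: le_fun_def \<Phi>_def)
    ultimately have "q = m" by (rule min)
    then have "m x \<le> m (x + y) - m y" using q_le[of 1 x] by (simp add: \<Phi>_def)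
    then show ?thesis using sublinear_add[OF m, of x y] by simp
  qed
  have neg: "m (- x) = - m x" for x
    using add[of x "-x"] sublinear_zero[OF m] by simp
  show ?thesis
  proof (rule linearI)
    fix c x
    show "m (c *\<^sub>R x) = c *\<^sub>R m x"
      using sublinear_scale[OF m, of c x] sublinear_scale[OF m, of "-c" "-x"] neg[of x]
      by (cases "c \<ge> 0") auto
  qed (rule add)
qed

text \<open>Zorn's lemma, applied to the sublinear functionals below \<open>p\<close>, gives a
  minimal one, and minimal ones are linear.\<close>

theorem sublinear_dominates_linear:
  fixes p :: "'a::real_vector \<Rightarrow> real"
  assumes p: "sublinear p"
  shows "\<exists>L. linear L \<and> L \<le> p"
proof -
  define A where "A = {q. sublinear q \<and> q \<le> p}"
  \<comment> \<open>The order is reversed, so a pointwise infimum is an upper bound of a chain and a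
    maximal element is a minimal functional.\<close>
  define P where "P = (\<lambda>q r :: 'a \<Rightarrow> real. r \<le> q)"
  have "\<exists>m\<in>A. \<forall>q\<in>A. P m q \<longrightarrow> q = m"
  proof (rule predicate_Zorn)
    show "partial_order_on A (relation_of P A)"
      by (rule partial_order_on_relation_ofI) (auto simp: P_def)
    fix C assume C: "C \<in> Chains (relation_of P A)"
    then have CA: "C \<subseteq> A" by (auto simp: Chains_def relation_of_def)
    have lin: "q \<le> r \<or> r \<le> q" if "q \<in> C" "r \<in> C" for q r
      using C that by (auto simp: Chains_def relation_of_def P_def)
    show "\<exists>u\<in>A. \<forall>q\<in>C. P q u"
    proof (cases "C = {}")
      case True
      then show ?thesis using p by (auto simp: A_def)
    next
      case False
      define u where "u x = (INF q\<in>C. q x)" for x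
      have sub: "sublinear q" if "q \<in> C" for q using that CA by (auto simp: A_def)
      have 1: "\<exists>k\<in>C. \<forall>x y. k (x + y) \<le> q x + r y" if "q \<in> C" "r \<in> C" for q r
      proof -
        obtain k where k: "k \<in> C" "k \<le> q" "k \<le> r" using lin[of q r] \<open>q \<in> C\<close> \<open>r \<in> C\<close> by auto
        show ?thesis
        proof (intro bexI[of _ k] allI k)
          fix x y
          show "k (x + y) \<le> q x + r y"
            using sublinear_add[OF sub[OF k(1)], of x y] le_funD[OF k(2), of x] le_funD[OF k(3), of y]
            by linarith
        qed
      qed
      have 2: "\<exists>k\<in>C. \<forall>x. k (c *\<^sub>R x) \<le> c * q x" if "q \<in> C" "c > 0" for c q
        using that sublinear_scale[OF sub] by (intro bexI[of _ q]) auto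
      have 3: "0 \<le> q 0" if "q \<in> C" for q
        using sublinear_zero[OF sub[OF that]] by simp
      have bdd: "bdd_below ((\<lambda>q. q x) ` C)" for x
        by (rule sublinear_INF(1)) (use False 1 2 3 in auto)
      have "sublinear u"
        unfolding u_def by (rule sublinear_INF(2)) (use False 1 2 3 in auto)
      moreover have u_le: "u \<le> q" if "q \<in> C" for q
        unfolding u_def le_fun_def using cINF_lower[OF bdd that] by auto
      moreover obtain q where q: "q \<in> C" using False by blast
      moreover have "q \<le> p" using q CA by (auto simp: A_def)
      ultimately have "u \<in> A" using order_trans[OF u_le[OF q]] by (simp add: A_def)
      then show ?thesis using u_le by (auto simp: P_def)
    qed
  qed
  then obtain m where m: "m \<in> A" "\<And>q. q \<in> A \<Longrightarrow> q \<le> m \<Longrightarrow> q = m" by (auto simp: P_def)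
  have "linear m"
    by (rule minimal_sublinear_linear) (use m in \<open>auto simp: A_def intro: order_trans\<close>)
  then show ?thesis using m(1) by (auto simp: A_def)
qed

section \<open>Means on bounded sequences and the multipliers\<close>

text \<open>Since \<open>nat\<close> is discrete, the bounded continuous functions on it serve as
  the space of all bounded sequences.\<close>

lemma real_Bcontfun_apply:
  fixes h :: "nat \<Rightarrow> real"
  assumes "bounded (range h)"
  shows "apply_bcontfun (Bcontfun h) = h"
  by (rule Bcontfun_inverse) (use assms in \<open>auto simp: bcontfun_def\<close>)

text \<open>
  Mass that the mean \<open>L\<close> leaves at infinity, \<open>1 - suminf \<beta>\<close>, only sees the limit of the sequence;
  this is where the multiplier \<open>\<alpha>\<^sub>\<infinity>\<close> comes from.
\<close>

lemma mean_functional_on_convergent: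
  fixes L :: "(nat \<Rightarrow>\<^sub>C real) \<Rightarrow> real"
  assumes L: "linear L" and L_le: "\<And>x c. (\<And>n. apply_bcontfun x n \<le> c) \<Longrightarrow> L x \<le> c"
  obtains \<beta> where "\<And>n::nat. \<beta> n \<ge> (0::real)" "summable \<beta>" "suminf \<beta> \<le> 1"
    "\<And>x l. apply_bcontfun x \<longlonglongrightarrow> l \<Longrightarrow> (\<lambda>n. \<beta> n * apply_bcontfun x n) sums (L x - (1 - suminf \<beta>) * l)"
proof -
  define e :: "nat \<Rightarrow> nat \<Rightarrow>\<^sub>C real" where "e k = Bcontfun (\<lambda>n. of_bool (n = k))" for k
  have e: "apply_bcontfun (e k) n = of_bool (n = k)" for k n
  proof -
    have "bounded (range (\<lambda>n. of_bool (n = k) :: real))"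
      by (rule boundedI[of _ 1]) auto
    then show ?thesis by (simp add: e_def real_Bcontfun_apply)
  qed
  define \<beta> where "\<beta> k = L (e k)" for k
  \<comment> \<open>Applied to \<open>- x\<close>, the upper bound becomes a lower one; thus
    \<open>L\<close> is positive and takes the value 1 on the constant sequence 1.\<close>
  have L_ge: "L x \<ge> c" if "\<And>n. apply_bcontfun x n \<ge> c" for x c
    using L_le[of "- x" "- c"] that linear_neg[OF L] by simp
  have one: "L (const_bcontfun 1) = 1"
    using L_le[of "const_bcontfun 1" 1] L_ge[of 1 "const_bcontfun 1"] by simp
  have pos: "\<beta> k \<ge> 0" for k
    unfolding \<beta>_def by (rule L_ge) (simp add: e)
  have esum: "apply_bcontfun (\<Sum>k<N. a k *\<^sub>R e k) n = (if n < N then a n else 0)" for a N n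
    by (induction N) (auto simp: e less_Suc_eq)
  have Lsum: "L (\<Sum>k<N. a k *\<^sub>R e k) = (\<Sum>k<N. a k * \<beta> k)" for a N
    by (simp add: linear_sum[OF L] linear_scale[OF L] \<beta>_def)
  have le1: "(\<Sum>k<N. \<beta> k) \<le> 1" for N
    using L_le[of "\<Sum>k<N. 1 *\<^sub>R e k" 1] Lsum[of "\<lambda>_. 1" N] esum[of "\<lambda>_. 1" N] by simp
  have sm: "summable \<beta>"
    by (rule bounded_imp_summable[of _ 1])
       (use pos le1[of "Suc _"] in \<open>auto simp: lessThan_Suc_atMost\<close>)
  have s1: "suminf \<beta> \<le> 1"
    by (rule suminf_le_const[OF sm le1])
  have "(\<lambda>n. \<beta> n * apply_bcontfun x n) sums (L x - (1 - suminf \<beta>) * l)" if x: "apply_bcontfun x \<longlonglongrightarrow> l" for x l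
  proof -
    have "(\<lambda>N. \<Sum>k<N. (apply_bcontfun x k - l) * \<beta> k) \<longlonglongrightarrow> L x - l"
    proof (rule LIMSEQ_I)
      fix r :: real assume r: "r > 0"
      obtain N0 where N0: "\<And>n. n \<ge> N0 \<Longrightarrow> \<bar>apply_bcontfun x n - l\<bar> < r / 2"
        using LIMSEQ_D[OF x, of "r/2"] r by auto
      have "norm ((\<Sum>k<N. (apply_bcontfun x k - l) * \<beta> k) - (L x - l)) < r" if N: "N \<ge> N0" for N
      proof -
        \<comment> \<open>\<open>z\<close> is \<open>x - l\<close> with its first \<open>N\<close>
          terms erased, so it is uniformly small and so is \<open>L z\<close>, which is exactly the
          error of the \<open>N\<close>-th partial sum.\<close>
        define z where "z = x - l *\<^sub>R const_bcontfun 1 - (\<Sum>k<N. (apply_bcontfun x k - l) *\<^sub>R e k)"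
        have z: "apply_bcontfun z n = (if n < N then 0 else apply_bcontfun x n - l)" for n
          by (simp add: z_def esum)
        have "\<bar>apply_bcontfun z n\<bar> \<le> r / 2" for n
          using N0[of n] N r by (auto simp: z)
        then have "apply_bcontfun z n \<le> r / 2" "- (r / 2) \<le> apply_bcontfun z n" for n
          by (simp_all only: abs_le_iff minus_le_iff)
        then have "L z \<le> r / 2" "L z \<ge> - (r / 2)"
          by - (rule L_le, blast, rule L_ge, blast)
        moreover have "L z = L x - l - (\<Sum>k<N. (apply_bcontfun x k - l) * \<beta> k)"
          by (simp add: z_def linear_diff[OF L] linear_scale[OF L] one Lsum)
        ultimately show ?thesis using r by (simp add: abs_if)
      qed
      then show "\<exists>N0. \<forall>N\<ge>N0. norm ((\<Sum>k<N. (apply_bcontfun x k - l) * \<beta> k) - (L x - l)) < r"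
        by blast
    qed
    then have "(\<lambda>k. (apply_bcontfun x k - l) * \<beta> k) sums (L x - l)" by (simp add: sums_def)
    from sums_add[OF this sums_mult[OF summable_sums[OF sm], of l]]
    show ?thesis by (simp add: algebra_simps)
  qed
  then show thesis using that pos sm s1 by blast
qed

text \<open>The \<open>F n\<close> are only sublinear, so the sequences
  \<open>\<lambda>n. F n u\<close> need not form a convex set as \<open>u\<close> varies; the
  infimum over \<open>u\<close> in \<open>q\<close> does the convexification. A linear
  \<open>L\<close> below \<open>q\<close> lies below every \<open>\<Phi> u\<close>: the choice
  \<open>u = 0\<close> makes it a mean, and general \<open>u\<close> makes it nonnegative on the
  sequences \<open>\<lambda>n. F n u\<close>.\<close>

theorem convergent_sublinear_multipliers:
  fixes F :: "nat \<Rightarrow> 'a::real_vector \<Rightarrow> real"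
  assumes F: "\<And>n. sublinear (F n)" and lim: "\<And>u. (\<lambda>n. F n u) \<longlonglongrightarrow> G u"
    and nonneg: "\<And>u. (SUP n. F n u) \<ge> 0"
  obtains \<beta> where "\<And>n::nat. \<beta> n \<ge> (0::real)" "summable \<beta>" "suminf \<beta> \<le> 1"
    "\<And>u. summable (\<lambda>n. \<beta> n * F n u)"
    "\<And>u. (1 - suminf \<beta>) * G u + (\<Sum>n. \<beta> n * F n u) \<ge> 0"
proof -
  have bF: "bounded (range (\<lambda>n. F n u))" for u
    using lim convergent_imp_bounded by blast
  define \<Phi> where "\<Phi> u x = (SUP n. apply_bcontfun x n + F n u)" for u and x :: "nat \<Rightarrow>\<^sub>C real"
  have bdd: "bdd_above (range (\<lambda>n. apply_bcontfun x n + F n u))" for x u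
    by (intro bounded_imp_bdd_above bounded_plus_comp bF bounded_apply_bcontfun)
  have \<Phi>_ge: "apply_bcontfun x n + F n u \<le> \<Phi> u x" for x n u
    unfolding \<Phi>_def by (rule cSUP_upper[OF _ bdd]) simp
  have \<Phi>_le: "\<Phi> u x \<le> b" if "\<And>n. apply_bcontfun x n + F n u \<le> b" for x u b
    unfolding \<Phi>_def by (rule cSUP_least) (use that in auto)
  have 1: "\<exists>k\<in>UNIV. \<forall>x y. \<Phi> k (x + y) \<le> \<Phi> u x + \<Phi> v y" for u v
  proof (intro bexI[of _ "u + v"] allI \<Phi>_le)
    fix x y n
    show "apply_bcontfun (x + y) n + F n (u + v) \<le> \<Phi> u x + \<Phi> v y"
      using sublinear_add[OF F, of n u v] \<Phi>_ge[of x n u] \<Phi>_ge[of y n v]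
      by simp
  qed simp
  have 2: "\<exists>k\<in>UNIV. \<forall>x. \<Phi> k (c *\<^sub>R x) \<le> c * \<Phi> u x" if c: "c > 0" for c u
  proof (intro bexI[of _ "c *\<^sub>R u"] allI \<Phi>_le)
    fix x n
    show "apply_bcontfun (c *\<^sub>R x) n + F n (c *\<^sub>R u) \<le> c * \<Phi> u x"
      using sublinear_scale[OF F, of c n u] mult_left_mono[OF \<Phi>_ge[of x n u], of c] c
      by (simp add: algebra_simps)
  qed simp
  \<comment> \<open>Here \<open>nonneg\<close> enters: \<open>\<Phi> u 0\<close> is the supremum of
    the \<open>F n u\<close>, and its sign keeps the infimum \<open>q\<close> finite.\<close>
  have 3: "0 \<le> \<Phi> u 0" for u
    using nonneg by (simp add: \<Phi>_def)
  define q where "q x = (INF u. \<Phi> u x)" for x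
  have bdd_q: "bdd_below (range (\<lambda>u. \<Phi> u x))" for x
    by (rule sublinear_INF(1)) (use 1 2 3 in auto)
  have "sublinear q"
    unfolding q_def by (rule sublinear_INF(2)) (use 1 2 3 in auto)
  then obtain L where L: "linear L" "L \<le> q" using sublinear_dominates_linear by blast
  have L_le: "L x \<le> \<Phi> u x" for x u
    using le_funD[OF L(2), of x] cINF_lower[OF bdd_q, of u x] by (auto simp: q_def)
  have dom: "L x \<le> c" if "\<And>n. apply_bcontfun x n \<le> c" for x c
    by (rule order_trans[OF L_le[of x 0] \<Phi>_le]) (use that sublinear_zero[OF F] in auto)
  obtain \<beta> where \<beta>: "\<And>n::nat. \<beta> n \<ge> (0::real)" "summable \<beta>" "suminf \<beta> \<le> 1"
    and sums: "\<And>x l. apply_bcontfun x \<longlonglongrightarrow> l \<Longrightarrow>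
      (\<lambda>n. \<beta> n * apply_bcontfun x n) sums (L x - (1 - suminf \<beta>) * l)"
    using mean_functional_on_convergent[OF L(1) dom] by blast
  have "summable (\<lambda>n. \<beta> n * F n u) \<and> (1 - suminf \<beta>) * G u + (\<Sum>n. \<beta> n * F n u) \<ge> 0" for u
  proof -
    define x where "x = Bcontfun (\<lambda>n. F n u)"
    have x: "apply_bcontfun x = (\<lambda>n. F n u)" unfolding x_def by (rule real_Bcontfun_apply[OF bF])
    have s: "(\<lambda>n. \<beta> n * F n u) sums (L x - (1 - suminf \<beta>) * G u)"
      using sums[of x "G u"] lim by (simp add: x)
    \<comment> \<open>Adding \<open>F n u\<close> to \<open>- x\<close> gives the zero sequence,
      whence \<open>\<Phi> u (- x) \<le> 0\<close>.\<close>
    have "L (- x) \<le> 0"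
      by (rule order_trans[OF L_le[of "- x" u] \<Phi>_le]) (simp add: x)
    then show ?thesis using s linear_neg[OF L(1), of x] by (auto simp: sums_iff)
  qed
  then show thesis using that \<beta> by blast
qed

section \<open>Dini derivatives along rays and their comparison\<close>

lemma eventually_line_in_open:
  fixes x u :: "'a::real_normed_vector"
  assumes "open S" "x \<in> S"
  shows "\<forall>\<^sub>F t in at 0. x + t *\<^sub>R u \<in> S" "\<forall>\<^sub>F t in at_right 0. x + t *\<^sub>R u \<in> S"
proof -
  have "((\<lambda>t. x + t *\<^sub>R u) \<longlongrightarrow> x + 0 *\<^sub>R u) (at 0)"
    by (intro tendsto_intros)
  then show "\<forall>\<^sub>F t in at 0. x + t *\<^sub>R u \<in> S"
    using topological_tendstoD[of _ _ _ S] assms by auto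
  then show "\<forall>\<^sub>F t in at_right 0. x + t *\<^sub>R u \<in> S"
    by (simp add: eventually_at_split)
qed

lemma Dini_less_imp_eventually:
  assumes "open S" "x \<in> S" "L-lipschitz_on S f" "Dini f x u < c"
  shows "\<forall>\<^sub>F t in at_right 0. f (x + t *\<^sub>R u) - f x < c * t"
proof -
  \<comment> \<open>The Lipschitz bound rules out the infinite values, which
    \<open>real_of_ereal\<close> would send to 0.\<close>
  have "upper_Dini f x u < ereal c"
    using ereal_Dini[OF assms(1-3), of u] assms(4) by (metis less_ereal.simps(1))
  then have "\<forall>\<^sub>F t in at_right 0. ereal ((f (x + t *\<^sub>R u) - f x) / t) < ereal c"
    unfolding upper_Dini_def by (rule Limsup_lessD)
  then show ?thesis
    using eventually_at_right_less[of "0::real"]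
    by eventually_elim (simp add: field_simps)
qed

lemma Dini_le_if_eventually:
  assumes "open S" "x \<in> S" "L-lipschitz_on S f"
    and ev: "\<forall>\<^sub>F t in at_right 0. f (x + t *\<^sub>R u) - f x \<le> c * t"
  shows "Dini f x u \<le> c"
proof -
  have "upper_Dini f x u \<le> ereal c"
    unfolding upper_Dini_def
  proof (rule Limsup_bounded)
    show "\<forall>\<^sub>F t in at_right 0. ereal ((f (x + t *\<^sub>R u) - f x) / t) \<le> ereal c"
      using ev eventually_at_right_less[of "0::real"]
      by eventually_elim (simp add: field_simps)
  qed
  then show ?thesis
    using ereal_Dini[OF assms(1-3), of u] by (metis ereal_less_eq(3))
qed

text \<open>Along the ray the increments of \<open>f\<close> exceed those of \<open>g\<close> by at
  most \<open>e * norm u * t\<close>. The bound is one-sided; exchanging \<open>f\<close> and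
  \<open>g\<close> gives the other half of an absolute estimate.\<close>

lemma Dini_le_add:
  fixes f g :: "'a::real_normed_vector \<Rightarrow> real"
  assumes S: "open S" "x \<in> S" and f: "K-lipschitz_on S f" and g: "L-lipschitz_on S g"
    and le: "\<And>y. y \<in> S \<Longrightarrow> (f y - g y) - (f x - g x) \<le> e * norm (y - x)"
  shows "Dini f x u \<le> Dini g x u + e * norm u"
proof (rule field_le_epsilon)
  fix d :: real assume "d > 0"
  then have "Dini g x u < Dini g x u + d" by simp
  from Dini_less_imp_eventually[OF S g this]
  have "\<forall>\<^sub>F t in at_right 0. f (x + t *\<^sub>R u) - f x \<le> (Dini g x u + e * norm u + d) * t"
    using eventually_line_in_open(2)[OF S, of u] eventually_at_right_less[of "0::real"]
  proof eventually_elim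
    case (elim t)
    then show ?case using le[of "x + t *\<^sub>R u"] by (simp add: algebra_simps)
  qed
  then show "Dini f x u \<le> Dini g x u + e * norm u + d"
    by (rule Dini_le_if_eventually[OF S f])
qed

text \<open>Comparison with the zero function in both directions. The estimate later makes the
  derivative of the limit function continuous.\<close>

lemma Dini_abs_le:
  fixes f :: "'a::real_normed_vector \<Rightarrow> real"
  assumes S: "open S" "x \<in> S" and f: "L-lipschitz_on S f"
  shows "\<bar>Dini f x u\<bar> \<le> L * norm u"
proof -
  have 0: "0-lipschitz_on S (\<lambda>_. 0::real)" by (simp add: lipschitz_on_def)
  have D0: "Dini (\<lambda>_. 0) x u = 0"
    by (simp add: Dini_def upper_Dini_def Limsup_const zero_ereal_def[symmetric])
  have le: "\<bar>f y - f x\<bar> \<le> L * norm (y - x)" if "y \<in> S" for y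
    using lipschitz_onD[OF f that S(2)] by (simp add: dist_norm)
  have "Dini f x u \<le> Dini (\<lambda>_. 0) x u + L * norm u"
    by (rule Dini_le_add[OF S f 0]) (use le in fastforce)
  moreover have "Dini (\<lambda>_. 0) x u \<le> Dini f x u + L * norm u"
    by (rule Dini_le_add[OF S 0 f]) (use le in fastforce)
  ultimately show ?thesis by (simp add: D0 abs_le_iff)
qed

lemma has_Gateaux_derivative_Dini:
  assumes "has_Gateaux_derivative f x d"
  shows "Dini f x = d"
proof
  fix u
  have "((\<lambda>t. (f (x + t *\<^sub>R u) - f x) / t) \<longlongrightarrow> d u) (at 0)"
    using assms by (simp add: has_Gateaux_derivative_def)
  then have "((\<lambda>t. (f (x + t *\<^sub>R u) - f x) / t) \<longlongrightarrow> d u) (at_right 0)"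
    by (simp add: filterlim_at_split)
  then have "((\<lambda>t. ereal ((f (x + t *\<^sub>R u) - f x) / t)) \<longlongrightarrow> ereal (d u)) (at_right 0)"
    by simp
  from lim_imp_Limsup[OF trivial_limit_at_right_real this]
  show "Dini f x u = d u" by (simp add: Dini_def upper_Dini_def)
qed

section \<open>Consequences of property (H)\<close>

lemma lip_seminorm_less:
  assumes "lip_seminorm S h < ennreal e" "e > 0" "x \<in> S" "y \<in> S"
  shows "\<bar>h y - h x\<bar> \<le> e * norm (y - x)"
proof (cases "y = x")
  case False
  have "ennreal (\<bar>h y - h x\<bar> / norm (y - x)) \<le> lip_seminorm S h"
    unfolding lip_seminorm_def by (rule SUP_upper2[of "(y, x)"]) (use assms False in auto)
  with assms(1) have "ennreal (\<bar>h y - h x\<bar> / norm (y - x)) < ennreal e" by order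
  then show ?thesis using False assms(2) by (simp add: ennreal_less_iff field_simps)
qed simp

lemma open_ext_ball: "open (ext_ball x r)"
  by (cases r) (auto simp: ext_ball_ereal ext_ball_infinity, simp add: ext_ball_def)

text \<open>Lipschitz convergence with one endpoint frozen at \<open>x\<close>, since the later
  arguments compare points with \<open>x\<close> only. The product form includes
  \<open>y = x\<close> and stays within the reals.\<close>

definition uniformly_first_order ::
  "'a::real_normed_vector set \<Rightarrow> (nat \<Rightarrow> 'a \<Rightarrow> real) \<Rightarrow> 'a \<Rightarrow> ('a \<Rightarrow> real) \<Rightarrow> bool" where
  "uniformly_first_order S f x g \<longleftrightarrow>
     (\<forall>e>0. \<forall>\<^sub>F n in sequentially. \<forall>y\<in>S. \<bar>(f n y - g y) - (f n x - g x)\<bar> \<le> e * norm (y - x))"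

lemma property_HE:
  assumes "property_H \<Omega> f xh finf" "open \<Omega>" "xh \<in> \<Omega>"
  obtains S where "open S" "xh \<in> S" "S \<subseteq> \<Omega>" "\<And>n. \<exists>L. L-lipschitz_on S (f n)"
    "\<exists>L. L-lipschitz_on S finf" "\<And>n. sublinear (Dini (f n) xh)" "(\<lambda>n. f n xh) \<longlonglongrightarrow> finf xh"
    "uniformly_first_order S f xh finf"
proof -
  obtain r where r: "r > 0" "\<And>n. \<exists>L. L-lipschitz_on (ext_ball xh r \<inter> \<Omega>) (f n)"
    "\<And>n. sublinear (Dini (f n) xh)"
    "\<exists>L. L-lipschitz_on (ext_ball xh r \<inter> \<Omega>) finf" "(\<lambda>n. f n xh) \<longlonglongrightarrow> finf xh"
    "(\<lambda>n. lip_seminorm (ext_ball xh r \<inter> \<Omega>) (\<lambda>x. f n x - finf x)) \<longlonglongrightarrow> 0"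
    using assms(1) unfolding property_H_def by blast
  have xh: "xh \<in> ext_ball xh r \<inter> \<Omega>"
    using r(1) assms(3) by (simp add: ext_ball_def zero_ereal_def[symmetric])
  have "uniformly_first_order (ext_ball xh r \<inter> \<Omega>) f xh finf"
    unfolding uniformly_first_order_def
  proof (intro allI impI)
    fix e :: real assume e: "e > 0"
    then have "0 < ennreal e" by simp
    from order_tendstoD(2)[OF r(6) this]
    show "\<forall>\<^sub>F n in sequentially. \<forall>y\<in>ext_ball xh r \<inter> \<Omega>.
        \<bar>(f n y - finf y) - (f n xh - finf xh)\<bar> \<le> e * norm (y - xh)"
      by eventually_elim (intro ballI lip_seminorm_less[OF _ e xh])
  qed
  with that[of "ext_ball xh r \<inter> \<Omega>"] show thesis
    using r xh assms(2) open_ext_ball by blast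
qed

text \<open>For large \<open>n\<close>, \<open>Dini_le_add\<close> applies to \<open>f n\<close> and
  \<open>g\<close> in both directions with the same small \<open>e\<close>.\<close>

lemma uniformly_first_order_Dini_tendsto:
  assumes S: "open S" "x \<in> S" and f: "\<And>n. \<exists>L. L-lipschitz_on S (f n)" and g: "\<exists>L. L-lipschitz_on S g"
    and unif: "uniformly_first_order S f x g"
  shows "(\<lambda>n. Dini (f n) x u) \<longlonglongrightarrow> Dini g x u"
proof (rule tendstoI)
  fix d :: real assume d: "d > 0"
  \<comment> \<open>The \<open>+ 1\<close> covers \<open>u = 0\<close> and makes
    \<open>e * norm u < d\<close> strict.\<close>
  define e where "e = d / (norm u + 1)"
  have e: "e > 0" "e * norm u < d"
    using d by (simp_all add: e_def field_simps add_pos_nonneg pos_divide_less_eq)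
  have "\<forall>\<^sub>F n in sequentially. \<forall>y\<in>S. \<bar>(f n y - g y) - (f n x - g x)\<bar> \<le> e * norm (y - x)"
    using unif e(1) by (simp add: uniformly_first_order_def)
  then show "\<forall>\<^sub>F n in sequentially. dist (Dini (f n) x u) (Dini g x u) < d"
  proof eventually_elim
    case (elim n)
    obtain K L where K: "K-lipschitz_on S (f n)" and L: "L-lipschitz_on S g" using f g by metis
    have "Dini (f n) x u \<le> Dini g x u + e * norm u"
      by (rule Dini_le_add[OF S K L]) (use elim in fastforce)
    moreover have "Dini g x u \<le> Dini (f n) x u + e * norm u"
      by (rule Dini_le_add[OF S L K]) (use elim in fastforce)
    ultimately show ?case using e(2) by (simp add: dist_real_def abs_if)
  qed
qed

text \<open>Linearity survives the pointwise limit of the derivatives, the Lipschitz constant of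
  \<open>g\<close> gives boundedness, and uniformity in \<open>y\<close> allows the limits in
  \<open>n\<close> and \<open>t\<close> to be interchanged.\<close>

lemma uniformly_first_order_Gateaux:
  assumes S: "open S" "x \<in> S" and f: "\<And>n. \<exists>L. L-lipschitz_on S (f n)" and g: "\<exists>L. L-lipschitz_on S g"
    and unif: "uniformly_first_order S f x g"
    and G: "\<And>n. has_Gateaux_derivative (f n) x (Dini (f n) x)"
  shows "has_Gateaux_derivative g x (Dini g x)"
proof -
  have lim: "(\<lambda>n. Dini (f n) x u) \<longlonglongrightarrow> Dini g x u" for u
    by (rule uniformly_first_order_Dini_tendsto[OF S f g unif])
  have lin: "linear (Dini (f n) x)" for n
    using G by (simp add: has_Gateaux_derivative_def bounded_linear.linear)
  obtain L where L: "L-lipschitz_on S g" using g by blast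
  have "bounded_linear (Dini g x)"
  proof (rule bounded_linear_intro)
    show "Dini g x (u + v) = Dini g x u + Dini g x v" for u v
      using LIMSEQ_unique[OF lim[of "u + v"]] tendsto_add[OF lim[of u] lim[of v]]
      by (simp add: linear_add[OF lin])
    show "Dini g x (c *\<^sub>R u) = c *\<^sub>R Dini g x u" for c u
      using LIMSEQ_unique[OF lim[of "c *\<^sub>R u"]] tendsto_mult_left[OF lim[of u], of c]
      by (simp add: linear_scale[OF lin])
    show "norm (Dini g x u) \<le> norm u * L" for u
      using Dini_abs_le[OF S L, of u] by (simp add: mult.commute)
  qed
  moreover have "((\<lambda>t. (g (x + t *\<^sub>R u) - g x) / t) \<longlongrightarrow> Dini g x u) (at 0)" for u
  proof (rule tendstoI)
    fix d :: real assume d: "d > 0"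
    define e where "e = d / 3 / (norm u + 1)"
    have e: "e > 0" "e * norm u < d / 3"
      using d by (simp_all add: e_def field_simps add_pos_nonneg pos_divide_less_eq)
    have "\<forall>\<^sub>F n in sequentially. (\<forall>y\<in>S. \<bar>(f n y - g y) - (f n x - g x)\<bar> \<le> e * norm (y - x)) \<and>
        dist (Dini (f n) x u) (Dini g x u) < d / 3"
      using unif e(1) tendstoD[OF lim, of "d/3" u] d
      by (intro eventually_conj) (auto simp: uniformly_first_order_def)
    \<comment> \<open>One index \<open>n\<close> is fixed before \<open>t\<close> tends to 0. Three
      errors below \<open>d / 3\<close> then add up: between the quotients of \<open>g\<close> and
      \<open>f n\<close>, between the quotient and the derivative of \<open>f n\<close>, and between
      the two derivatives.\<close>
    from eventually_happens[OF this] obtain n where n: "\<And>y. y \<in> S \<Longrightarrow> \<bar>(f n y - g y) - (f n x - g x)\<bar> \<le> e * norm (y - x)"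
      "\<bar>Dini (f n) x u - Dini g x u\<bar> < d / 3"
      by (auto simp: dist_real_def)
    have "((\<lambda>t. (f n (x + t *\<^sub>R u) - f n x) / t) \<longlongrightarrow> Dini (f n) x u) (at 0)"
      using G by (simp add: has_Gateaux_derivative_def)
    from tendstoD[OF this, of "d/3"] d
    have "\<forall>\<^sub>F t in at 0. dist ((f n (x + t *\<^sub>R u) - f n x) / t) (Dini (f n) x u) < d / 3" by simp
    moreover have "\<forall>\<^sub>F t in at (0::real). t \<noteq> 0" by (simp add: eventually_at_filter)
    ultimately show "\<forall>\<^sub>F t in at 0. dist ((g (x + t *\<^sub>R u) - g x) / t) (Dini g x u) < d"
      using eventually_line_in_open(1)[OF S, of u]
    proof eventually_elim
      case (elim t)
      have "(f n (x + t *\<^sub>R u) - f n x) / t - (g (x + t *\<^sub>R u) - g x) / t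
          = ((f n (x + t *\<^sub>R u) - g (x + t *\<^sub>R u)) - (f n x - g x)) / t"
        by (simp add: diff_divide_distrib)
      moreover have "\<bar>\<dots>\<bar> \<le> e * norm u"
        using n(1)[OF elim(3)] elim(2) by (simp add: field_simps)
      ultimately show ?case
        using n(2) e(2) elim(1) unfolding dist_real_def by linarith
    qed
  qed
  ultimately show ?thesis by (simp add: has_Gateaux_derivative_def)
qed

section \<open>Optimality excludes common descent directions\<close>

text \<open>Each constraint taken alone survives for small \<open>t\<close>, but how small depends
  on \<open>n\<close>. Comparison with \<open>finf\<close> controls a whole tail
  \<open>n \<ge> N\<close> at once; finitely many constraints remain, and a common \<open>t\<close>
  contradicts optimality.\<close>

lemma no_common_descent_direction:
  assumes S: "open S" "xh \<in> S" "S \<subseteq> \<Omega>"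
    and f: "\<And>n. \<exists>L. L-lipschitz_on S (f n)" and finf: "\<exists>L. L-lipschitz_on S finf"
    and lim: "(\<lambda>n. f n xh) \<longlonglongrightarrow> finf xh" and unif: "uniformly_first_order S f xh finf"
    and opt: "optimal_solution \<Omega> f xh"
    and d0: "Dini (f 0) xh u < 0" and d: "\<And>n. n \<ge> 1 \<Longrightarrow> f n xh = 0 \<Longrightarrow> Dini (f n) xh u < 0"
    and dinf: "finf xh = 0 \<Longrightarrow> Dini finf xh u < 0"
  shows False
proof -
  have feas: "f n xh \<le> 0" if "n \<ge> 1" for n
    using opt that by (auto simp: optimal_solution_def feasible_set_def)
  have inS: "\<forall>\<^sub>F t in at_right 0. xh + t *\<^sub>R u \<in> S"
    by (rule eventually_line_in_open(2)[OF S(1,2)])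
  have pos: "\<forall>\<^sub>F t in at_right (0::real). t > 0" by (rule eventually_at_right_less)
  have cont: "((\<lambda>t. h (xh + t *\<^sub>R u)) \<longlongrightarrow> h xh) (at_right 0)" if h: "\<exists>L. L-lipschitz_on S h"
    for h :: "'a \<Rightarrow> real"
  proof -
    have "isCont h xh"
      using h S lipschitz_on_continuous_on continuous_on_eq_continuous_at by blast
    moreover have "((\<lambda>t. xh + t *\<^sub>R u) \<longlongrightarrow> xh + 0 *\<^sub>R u) (at_right 0)"
      by (intro tendsto_intros)
    ultimately show ?thesis by (auto intro: isCont_tendsto_compose)
  qed
  have dec: "\<forall>\<^sub>F t in at_right 0. h (xh + t *\<^sub>R u) < h xh"
    if h: "\<exists>L. L-lipschitz_on S h" and neg: "Dini h xh u < 0" for h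
    using Dini_less_imp_eventually[of S xh _ h u 0] h neg S by fastforce
  have each: "\<forall>\<^sub>F t in at_right 0. f n (xh + t *\<^sub>R u) \<le> 0" if n: "n \<ge> 1" for n
  proof (cases "f n xh = 0")
    case True
    show ?thesis using dec[OF f d[OF n True]] by eventually_elim (use True in simp)
  next
    case False
    then have "f n xh < 0" using feas[OF n] by simp
    from order_tendstoD(2)[OF cont[OF f] this] show ?thesis by (rule eventually_mono) simp
  qed
  have "finf xh \<le> 0"
    by (rule LIMSEQ_le_const2[OF lim]) (use feas in blast)
  have tail: "\<exists>N. \<forall>\<^sub>F t in at_right 0. \<forall>n\<ge>N. n \<ge> 1 \<longrightarrow> f n (xh + t *\<^sub>R u) \<le> 0"
  proof (cases "finf xh = 0")
    case True
    \<comment> \<open>Halving makes \<open>Dini finf xh u < - c\<close> strict; the increments of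
      \<open>f n\<close> exceed those of \<open>finf\<close> by at most \<open>c * t\<close>, so
      they stay negative.\<close>
    define c where "c = - Dini finf xh u / 2"
    have c: "c > 0" "Dini finf xh u < - c" using dinf[OF True] by (simp_all add: c_def)
    define e where "e = c / (norm u + 1)"
    have e: "e > 0" "e * norm u < c"
      using c(1) by (simp_all add: e_def field_simps add_pos_nonneg pos_divide_less_eq)
    obtain N where N: "\<And>n y. n \<ge> N \<Longrightarrow> y \<in> S \<Longrightarrow>
        \<bar>(f n y - finf y) - (f n xh - finf xh)\<bar> \<le> e * norm (y - xh)"
      using unif e(1) unfolding uniformly_first_order_def eventually_sequentially by meson
    have "\<forall>\<^sub>F t in at_right 0. finf (xh + t *\<^sub>R u) - finf xh < - c * t"
      using Dini_less_imp_eventually[OF S(1,2) _ c(2)] finf by blast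
    then have "\<forall>\<^sub>F t in at_right 0. \<forall>n\<ge>N. n \<ge> 1 \<longrightarrow> f n (xh + t *\<^sub>R u) \<le> 0"
      using inS pos
    proof eventually_elim
      case (elim t)
      have "e * norm u * t \<le> c * t" using e(2) elim(3) by simp
      show ?case
      proof (intro allI impI)
        fix n assume n: "n \<ge> N" "n \<ge> 1"
        have "f n (xh + t *\<^sub>R u) - f n xh
            \<le> (finf (xh + t *\<^sub>R u) - finf xh) + e * norm u * t"
          using N[OF n(1) elim(2)] elim(3) by (simp add: abs_le_iff algebra_simps)
        then show "f n (xh + t *\<^sub>R u) \<le> 0"
          using elim(1) \<open>e * norm u * t \<le> c * t\<close> feas[OF n(2)] by simp
      qed
    qed
    then show ?thesis by blast
  next
    case False
    \<comment> \<open>Here the constraints have slack: \<open>f n xh < finf xh / 2\<close> for large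
      \<open>n\<close>. The tolerance 1 adds only \<open>norm (t *\<^sub>R u)\<close>, which
      vanishes with \<open>t\<close>, and continuity of \<open>finf\<close> does the rest.\<close>
    then have neg: "finf xh < finf xh / 2" "finf xh / 2 < 0" using \<open>finf xh \<le> 0\<close> by auto
    have "\<forall>\<^sub>F n in sequentially. (\<forall>y\<in>S. \<bar>(f n y - finf y) - (f n xh - finf xh)\<bar> \<le> 1 * norm (y - xh))
        \<and> f n xh < finf xh / 2"
      using unif unfolding uniformly_first_order_def
      by (intro eventually_conj order_tendstoD(2)[OF lim neg(1)]) (use zero_less_one in blast)
    then obtain N where N: "\<And>n y. n \<ge> N \<Longrightarrow> y \<in> S \<Longrightarrow>
        \<bar>(f n y - finf y) - (f n xh - finf xh)\<bar> \<le> 1 * norm (y - xh)"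
      "\<And>n. n \<ge> N \<Longrightarrow> f n xh < finf xh / 2"
      unfolding eventually_sequentially by meson
    have "((\<lambda>t. finf (xh + t *\<^sub>R u) - finf xh / 2 + norm (t *\<^sub>R u)) \<longlongrightarrow>
        finf xh - finf xh / 2 + norm (0 *\<^sub>R u)) (at_right 0)"
      by (intro tendsto_intros cont finf)
    then have "\<forall>\<^sub>F t in at_right 0. finf (xh + t *\<^sub>R u) - finf xh / 2 + norm (t *\<^sub>R u) < 0"
      by (rule order_tendstoD(2)) (use neg in simp)
    then have "\<forall>\<^sub>F t in at_right 0. \<forall>n\<ge>N. n \<ge> 1 \<longrightarrow> f n (xh + t *\<^sub>R u) \<le> 0"
      using inS
    proof eventually_elim
      case (elim t)
      show ?case
      proof (intro allI impI)
        fix n assume n: "n \<ge> N"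
        show "f n (xh + t *\<^sub>R u) \<le> 0"
          using N(1)[OF n elim(2)] N(2)[OF n] elim(1) neg(2) by (simp add: abs_le_iff)
      qed
    qed
    then show ?thesis by blast
  qed
  then obtain N where N: "\<forall>\<^sub>F t in at_right 0. \<forall>n\<ge>N. n \<ge> 1 \<longrightarrow> f n (xh + t *\<^sub>R u) \<le> 0" by blast
  have "\<forall>\<^sub>F t in at_right 0. \<forall>n\<in>{1..<N}. f n (xh + t *\<^sub>R u) \<le> 0"
    by (intro eventually_ball_finite) (use each in auto)
  with N inS dec[OF f d0]
  have "\<forall>\<^sub>F t in at_right (0::real). False"
  proof eventually_elim
    case (elim t)
    have "f n (xh + t *\<^sub>R u) \<le> 0" if "n \<ge> 1" for n
      using elim(1,4) that by (cases "n < N") auto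
    then have "xh + t *\<^sub>R u \<in> feasible_set \<Omega> f"
      using elim(2) S(3) by (auto simp: feasible_set_def)
    then show False using opt elim(3) by (force simp: optimal_solution_def)
  qed
  then show False by simp
qed

section \<open>Multipliers, the constraint qualification and the Gateaux case\<close>

theorem corollary2:
  fixes \<Omega> :: "'a::real_normed_vector set"
    and xh :: 'a
    and f :: "nat \<Rightarrow> 'a \<Rightarrow> real"
    and finf :: "'a \<Rightarrow> real"
  assumes "open \<Omega>" and "xh \<in> \<Omega>"
    and "property_H \<Omega> f xh finf"
    and "optimal_solution \<Omega> f xh"
  shows "\<exists>(\<alpha>inf::real) (\<alpha>::nat \<Rightarrow> real).
      (\<alpha>inf \<ge> 0 \<and> (\<forall>n. \<alpha> n \<ge> 0) \<and> summable \<alpha> \<and> \<alpha>inf + (\<Sum>n. \<alpha> n) = 1) \<and>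
      (\<alpha>inf * finf xh = 0 \<and> (\<forall>n\<ge>1. \<alpha> n * f n xh = 0)) \<and>
      (\<forall>u. summable (\<lambda>n. \<alpha> n * Dini (f n) xh u) \<and>
           \<alpha>inf * Dini finf xh u + (\<Sum>n. \<alpha> n * Dini (f n) xh u) \<ge> 0) \<and>
      ((\<exists>w. (SUP n\<in>{1..}. upper_Dini (f n) xh w) < 0) \<longrightarrow> \<alpha> 0 \<noteq> 0) \<and>
      ((\<forall>n. Gateaux_differentiable (f n) xh) \<longrightarrow>
         Gateaux_differentiable finf xh \<and>
         (\<forall>u. summable (\<lambda>n. \<alpha> n * Gateaux_derivative (f n) xh u) \<and>
              \<alpha>inf * Gateaux_derivative finf xh u
                + (\<Sum>n. \<alpha> n * Gateaux_derivative (f n) xh u) = 0))"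
proof -
  obtain S where S: "open S" "xh \<in> S" "S \<subseteq> \<Omega>"
    and lf: "\<And>n. \<exists>L. L-lipschitz_on S (f n)" and linf: "\<exists>L. L-lipschitz_on S finf"
    and sub: "\<And>n. sublinear (Dini (f n) xh)" and lim: "(\<lambda>n. f n xh) \<longlonglongrightarrow> finf xh"
    and unif: "uniformly_first_order S f xh finf"
    using property_HE[OF assms(3,1,2)] by blast
  define D where "D n = Dini (f n) xh" for n
  have limD: "(\<lambda>n. D n u) \<longlonglongrightarrow> Dini finf xh u" for u
    unfolding D_def by (rule uniformly_first_order_Dini_tendsto[OF S(1,2) lf linf unif])
  have subD: "sublinear (D n)" for n using sub by (simp add: D_def)
  \<comment> \<open>Property (H) states sublinearity for the \<open>f n\<close>; it passes to the
    pointwise limit.\<close>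
  have subinf: "sublinear (Dini finf xh)"
    unfolding sublinear_def
  proof (intro conjI allI impI)
    fix u v
    show "Dini finf xh (u + v) \<le> Dini finf xh u + Dini finf xh v"
      by (rule LIMSEQ_le[OF limD tendsto_add[OF limD limD]]) (use sublinear_add[OF subD] in blast)
    fix c :: real assume "c \<ge> 0"
    then have "(\<lambda>n. D n (c *\<^sub>R u)) \<longlonglongrightarrow> c * Dini finf xh u"
      using tendsto_mult_left[OF limD[of u], of c] by (simp add: sublinear_scale[OF subD])
    then show "Dini finf xh (c *\<^sub>R u) = c * Dini finf xh u"
      using LIMSEQ_unique limD by blast
  qed
  \<comment> \<open>An inactive \<open>f n\<close> gets the limit derivative \<open>G\<close>, so that \<open>F n\<close> still converges and the weight
    on the inactive indices can be moved to the limit.\<close>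
  define act where "act n \<longleftrightarrow> n = 0 \<or> f n xh = 0" for n
  define G where "G = (if finf xh = 0 then Dini finf xh else D 0)"
  define F where "F n = (if act n then D n else G)" for n
  have subF: "sublinear (F n)" for n using subD subinf by (simp add: F_def G_def)
  have limF: "(\<lambda>n. F n u) \<longlonglongrightarrow> G u" for u
  proof (cases "finf xh = 0")
    case True
    then have "(\<lambda>n. D n u - G u) \<longlonglongrightarrow> 0" using limD[of u] by (simp add: G_def LIM_zero)
    \<comment> \<open>Active and inactive indices may alternate forever here, but each
      \<open>F n u - G u\<close> is either \<open>D n u - G u\<close> or 0.\<close>
    then have "(\<lambda>n. F n u - G u) \<longlonglongrightarrow> 0"
      by (rule Lim_null_comparison[OF _ tendsto_norm_zero, rotated]) (simp add: F_def)
    then show ?thesis by (rule LIM_zero_cancel)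
  next
    case False
    have "\<forall>\<^sub>F n in sequentially. f n xh \<noteq> 0"
      using tendsto_imp_eventually_ne[OF lim False] .
    then have "\<forall>\<^sub>F n in sequentially. F n u = G u"
      using eventually_gt_at_top[of 0] by eventually_elim (simp add: F_def act_def)
    then show ?thesis by (rule tendsto_eventually)
  qed
  have nonneg: "(SUP n. F n u) \<ge> 0" for u
  proof (rule ccontr)
    assume neg: "\<not> (SUP n. F n u) \<ge> 0"
    have "bdd_above (range (\<lambda>n. F n u))"
      using convergent_imp_bounded[OF limF] by (rule bounded_imp_bdd_above)
    then have le: "F n u \<le> (SUP n. F n u)" for n by (rule cSUP_upper[OF UNIV_I])
    then have F_neg: "F n u < 0" for n using neg by (meson not_le order_le_less_trans)
    \<comment> \<open>Negative terms alone could tend to 0; the negative supremum forces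
      \<open>G u < 0\<close>.\<close>
    have "G u \<le> (SUP n. F n u)" by (rule LIMSEQ_le_const2[OF limF]) (use le in blast)
    then have "G u < 0" using neg by linarith
    show False
    proof (rule no_common_descent_direction[OF S lf linf lim unif assms(4)])
      show "Dini (f 0) xh u < 0" using F_neg[of 0] by (simp add: F_def act_def D_def)
      show "Dini (f n) xh u < 0" if "n \<ge> 1" "f n xh = 0" for n
        using F_neg[of n] that by (simp add: F_def act_def D_def)
      show "Dini finf xh u < 0" if "finf xh = 0" using \<open>G u < 0\<close> that by (simp add: G_def)
    qed
  qed
  obtain \<beta> where \<beta>: "\<And>n. \<beta> n \<ge> 0" "summable \<beta>" "suminf \<beta> \<le> 1"
    "\<And>u. summable (\<lambda>n. \<beta> n * F n u)"
    "\<And>u. (1 - suminf \<beta>) * G u + (\<Sum>n. \<beta> n * F n u) \<ge> 0"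
    using convergent_sublinear_multipliers[OF subF limF nonneg] by blast
  define a where "a n = (if act n then \<beta> n else 0)" for n
  have a0: "a n \<ge> 0" for n using \<beta>(1) by (simp add: a_def)
  have a: "summable a"
    by (rule summable_comparison_test[OF _ \<beta>(2)]) (use \<beta>(1) in \<open>auto simp: a_def\<close>)
  have a1: "suminf a \<le> 1"
    using suminf_le[OF _ a \<beta>(2)] \<beta>(1,3) by (fastforce simp: a_def)
  have aD: "summable (\<lambda>n. a n * D n u)" "(1 - suminf a) * G u + (\<Sum>n. a n * D n u) \<ge> 0" for u
  proof -
    \<comment> \<open>On an inactive index \<open>F n\<close> is \<open>G\<close>, so the weight
      \<open>\<beta> n\<close> dropped from \<open>a\<close> reappears in the coefficient of
      \<open>G\<close>, which grows from \<open>1 - suminf \<beta>\<close> to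
      \<open>1 - suminf a\<close>.\<close>
    have "a n * D n u = \<beta> n * F n u - (\<beta> n - a n) * G u" for n
      by (simp add: a_def F_def)
    then have "(\<lambda>n. a n * D n u) sums ((\<Sum>n. \<beta> n * F n u) - (suminf \<beta> - suminf a) * G u)"
      by (simp only:) (intro sums_diff sums_mult2 summable_sums \<beta> a)
    then show "summable (\<lambda>n. a n * D n u)" "(1 - suminf a) * G u + (\<Sum>n. a n * D n u) \<ge> 0"
      using \<beta>(5)[of u] by (auto simp: sums_iff algebra_simps)
  qed
  obtain \<alpha>inf \<alpha> where
    \<alpha>: "\<alpha>inf \<ge> 0" "\<And>n. \<alpha> n \<ge> 0" "summable \<alpha>" "\<alpha>inf + suminf \<alpha> = 1"
    and compl: "\<alpha>inf * finf xh = 0" "\<And>n. n \<ge> 1 \<Longrightarrow> \<alpha> n * f n xh = 0"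
    and \<alpha>D: "\<And>u. summable (\<lambda>n. \<alpha> n * D n u)"
      "\<And>u. \<alpha>inf * Dini finf xh u + (\<Sum>n. \<alpha> n * D n u) \<ge> 0"
  proof (cases "finf xh = 0")
    case True
    show thesis
      by (rule that[of "1 - suminf a" a]) (use True a0 a a1 aD in \<open>auto simp: a_def act_def G_def\<close>)
  next
    case False
    \<comment> \<open>In this case \<open>G\<close> is \<open>D 0\<close>, so the mass at infinity
      is placed on index 0, which carries no complementarity condition, and the multiplier of
      \<open>finf\<close> becomes 0.\<close>
    define \<delta> where "\<delta> n = (if n = 0 then 1 - suminf a else 0)" for n :: nat
    have \<delta>: "(\<lambda>n. \<delta> n * h n) sums ((1 - suminf a) * h 0)" for h
      using sums_finite[of "{0}" "\<lambda>n. \<delta> n * h n"] by (simp add: \<delta>_def)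
    have s1: "(\<lambda>n. a n + \<delta> n) sums 1"
      using sums_add[OF summable_sums[OF a] \<delta>[of "\<lambda>_. 1"]] by simp
    have s2: "(\<lambda>n. (a n + \<delta> n) * D n u) sums ((\<Sum>n. a n * D n u) + (1 - suminf a) * D 0 u)" for u
      using sums_add[OF summable_sums[OF aD(1)] \<delta>[of "\<lambda>n. D n u"]] by (simp add: algebra_simps)
    show thesis
    proof (rule that[of 0 "\<lambda>n. a n + \<delta> n"])
      show "0 * Dini finf xh u + (\<Sum>n. (a n + \<delta> n) * D n u) \<ge> 0" for u
        using s2[of u] aD(2)[of u] False by (simp add: G_def sums_iff)
    qed (use a0 a1 s1 s2 in \<open>auto simp: sums_iff a_def act_def \<delta>_def\<close>)
  qed
  have slater: "\<alpha> 0 \<noteq> 0" if w: "(SUP n\<in>{1..}. upper_Dini (f n) xh w) < 0" for w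
  proof
    assume "\<alpha> 0 = 0"
    \<comment> \<open>This \<open>c\<close> bounds every \<open>D n w\<close> with
      \<open>n \<ge> 1\<close> and, in the limit, \<open>Dini finf xh w\<close>. If
      \<open>\<alpha> 0 = 0\<close>, the weights of these terms total 1, so the combination is at
      most \<open>c < 0\<close>.\<close>
    obtain c where c: "(SUP n\<in>{1..}. upper_Dini (f n) xh w) < ereal c" "ereal c < 0"
      using ereal_dense2[OF w] by blast
    have Dc: "D n w \<le> c" if "n \<ge> 1" for n
    proof -
      obtain L where L: "L-lipschitz_on S (f n)" using lf by blast
      have "upper_Dini (f n) xh w \<le> (SUP n\<in>{1..}. upper_Dini (f n) xh w)"
        by (rule SUP_upper) (use that in simp)
      with c(1) have "ereal (D n w) \<le> ereal c"
        unfolding D_def ereal_Dini[OF S(1,2) L] by order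
      then show ?thesis by simp
    qed
    have "Dini finf xh w \<le> c" by (rule LIMSEQ_le_const2[OF limD]) (use Dc in blast)
    then have "\<alpha>inf * Dini finf xh w \<le> \<alpha>inf * c" using \<alpha>(1) by (rule mult_left_mono)
    moreover have "(\<Sum>n. \<alpha> n * D n w) \<le> (\<Sum>n. \<alpha> n * c)"
    proof (rule suminf_le)
      show "\<alpha> n * D n w \<le> \<alpha> n * c" for n
        using Dc[of n] \<alpha>(2)[of n] \<open>\<alpha> 0 = 0\<close> by (cases "n = 0") (auto intro: mult_left_mono)
    qed (use \<alpha>D \<alpha>(3) in \<open>auto intro: summable_mult2\<close>)
    moreover have "(\<Sum>n. \<alpha> n * c) = suminf \<alpha> * c" by (rule suminf_mult2[OF \<alpha>(3), symmetric])
    ultimately have "0 \<le> (\<alpha>inf + suminf \<alpha>) * c" using \<alpha>D(2)[of w] by (simp add: algebra_simps)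
    then show False using \<alpha>(4) c(2) by simp
  qed
  have gateaux: "Gateaux_differentiable finf xh \<and>
      (\<forall>u. summable (\<lambda>n. \<alpha> n * Gateaux_derivative (f n) xh u) \<and>
        \<alpha>inf * Gateaux_derivative finf xh u + (\<Sum>n. \<alpha> n * Gateaux_derivative (f n) xh u) = 0)"
    if gd: "\<forall>n. Gateaux_differentiable (f n) xh"
  proof -
    have hD: "has_Gateaux_derivative (f n) xh (D n)" for n
      using gd has_Gateaux_derivative_Dini unfolding D_def Gateaux_differentiable_def by metis
    have hinf: "has_Gateaux_derivative finf xh (Dini finf xh)"
      by (rule uniformly_first_order_Gateaux[OF S(1,2) lf linf unif]) (use hD in \<open>simp add: D_def\<close>)
    have neg: "D n (- u) = - D n u" "Dini finf xh (- u) = - Dini finf xh u" for n u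
      using hD hinf by (auto simp: has_Gateaux_derivative_def bounded_linear.linear linear_neg)
    have "\<alpha>inf * Dini finf xh u + (\<Sum>n. \<alpha> n * D n u) = 0" for u
      using \<alpha>D(2)[of u] \<alpha>D(2)[of "- u"] by (simp add: neg suminf_minus[OF \<alpha>D(1)])
    then show ?thesis
      using \<alpha>D(1) hinf
      by (auto simp: Gateaux_derivative_eqI[OF hD] Gateaux_derivative_eqI[OF hinf] Gateaux_differentiable_def)
  qed
  show ?thesis
    using \<alpha> compl \<alpha>D slater gateaux unfolding D_def
    by (intro exI[of _ \<alpha>inf] exI[of _ \<alpha>] conjI allI impI) blast+
qed

end
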